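(* Let $m\ge 2$, let $G=(V,E)$ be a unit disk graph that has a $(2,m)$-CDS, and let $\mathrm{OPT}$ be the minimum cardinality of a $(2,m)$-CDS of $G$. Then the algorithm of Shang et al. (described in the context) attains approximation factor $5+35/m$ for $2\le m\le 5$ and $13-5/m$ for $m\ge 6$; that is, the $(2,m)$-CDS $T\cup S$ it outputs satisfies $|T\cup S|\le (5+35/m)\,\mathrm{OPT}$ if $2\le m\le 5$, and $|T\cup S|\le(13-5/m)\,\mathrm{OPT}$ if $m\ge 6$.
   Context: In a unit disk graph, each node is placed at a point of the Euclidean plane, and two nodes are joined by an edge if and only if their distance is at most a unit length. $G[X]$ is the subgraph induced by $X$. A graph is $k$-connected if it is connected even when any $k-1$ or fewer nodes are removed (a complete graph on at most $k$ nodes is $k$-connected by convention). A $(k,m)$-CDS is a set $S\subseteq V$ such that $G[S]$ is $k$-connected and each node of $V\setminus S$ has at least $m$ neighbors in $S$. For $X\subseteq V$: $\Gamma(X)$ is the set of nodes outside $X$ adjacent to a node of $X$, $X^+=X\cup\Gamma(X)$, $\Gamma_T(X)=\Gamma(X)\cap T$. A $T$-cut is a set $X\subseteq T$ with $X\neq\emptyset\neq T\setminus X^+$. A $T$-path is a path whose two end nodes are in $T$ and whose inner nodes are not in $T$; it covers a $T$-cut $X$ if one end node is in $X$ and the other is in $T\setminus X^+$. Algorithm of Shang et al.: Let $I_0=\emptyset$. For $i=1,\dots,m$, compute a maximal independent set $I_i$ of $G[V\setminus\bigcup_{i'=0}^{i-1}I_{i'}]$; also compute $C\subseteq V\setminus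 I_1$ with $|C|\le|I_1|$ and $G[C\cup I_1]$ connected. Set $T=\bigcup_{i=1}^m I_i\cup C$ (a $(1,m)$-CDS) and $S=\emptyset$. While $T\cup S$ is not $2$-connected: find a $T$-cut $X$ with $|\Gamma_T(X)|=1$ that is covered by no $T$-path of $G[T\cup S]$; find a $T$-path of $G$ that covers $X$ and has at most two inner nodes; add these inner nodes to $S$. Output $T\cup S$. *)

theory Defs
  imports "HOL-Analysis.Analysis"
begin

text \<open>Finite simple undirected graphs with node set \<open>V\<close> and adjacency relation \<open>E\<close>.\<close>

definition simple_graph :: "'a set \<Rightarrow> ('a \<Rightarrow> 'a \<Rightarrow> bool) \<Rightarrow> bool" where
  "simple_graph V E \<longleftrightarrow>
     finite V \<and> (\<forall>u v. E u v \<longrightarrow> u \<in> V \<and> v \<in> V \<and> u \<noteq> v \<and> E v u)"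

text \<open>The placement \<open>p\<close> need not be injective: distinct nodes may share a point.\<close>

definition unit_disk_graph :: "'a set \<Rightarrow> ('a \<Rightarrow> 'a \<Rightarrow> bool) \<Rightarrow> bool" where
  "unit_disk_graph V E \<longleftrightarrow> simple_graph V E \<and>
     (\<exists>p :: 'a \<Rightarrow> real^2. \<forall>u\<in>V. \<forall>v\<in>V. u \<noteq> v \<longrightarrow> (E u v \<longleftrightarrow> dist (p u) (p v) \<le> 1))"

definition path_in :: "('a \<Rightarrow> 'a \<Rightarrow> bool) \<Rightarrow> 'a set \<Rightarrow> 'a list \<Rightarrow> bool" where
  "path_in E X xs \<longleftrightarrow> xs \<noteq> [] \<and> distinct xs \<and> set xs \<subseteq> X \<and> successively E xs"

text \<open>Connectedness of \<open>G[X]\<close>; the graph without nodes counts as connected.\<close>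

definition conn :: "('a \<Rightarrow> 'a \<Rightarrow> bool) \<Rightarrow> 'a set \<Rightarrow> bool" where
  "conn E X \<longleftrightarrow> (\<forall>u\<in>X. \<forall>v\<in>X. \<exists>xs. path_in E X xs \<and> hd xs = u \<and> last xs = v)"

definition complete_on :: "('a \<Rightarrow> 'a \<Rightarrow> bool) \<Rightarrow> 'a set \<Rightarrow> bool" where
  "complete_on E X \<longleftrightarrow> (\<forall>u\<in>X. \<forall>v\<in>X. u \<noteq> v \<longrightarrow> E u v)"

definition k_conn :: "('a \<Rightarrow> 'a \<Rightarrow> bool) \<Rightarrow> nat \<Rightarrow> 'a set \<Rightarrow> bool" where
  "k_conn E k X \<longleftrightarrow>
     (\<forall>R\<subseteq>X. card R \<le> k - 1 \<longrightarrow> conn E (X - R)) \<or> (complete_on E X \<and> card X \<le> k)"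

definition is_CDS :: "'a set \<Rightarrow> ('a \<Rightarrow> 'a \<Rightarrow> bool) \<Rightarrow> nat \<Rightarrow> nat \<Rightarrow> 'a set \<Rightarrow> bool" where
  "is_CDS V E k m S \<longleftrightarrow>
     S \<subseteq> V \<and> k_conn E k S \<and> (\<forall>v\<in>V - S. m \<le> card {u\<in>S. E v u})"

text \<open>Meaningful only if \<open>V\<close> is finite and some \<open>(k,m)\<close>-CDS exists.\<close>

definition CDS_opt :: "'a set \<Rightarrow> ('a \<Rightarrow> 'a \<Rightarrow> bool) \<Rightarrow> nat \<Rightarrow> nat \<Rightarrow> nat" where
  "CDS_opt V E k m = Min (card ` {S. is_CDS V E k m S})"

definition Nbh :: "'a set \<Rightarrow> ('a \<Rightarrow> 'a \<Rightarrow> bool) \<Rightarrow> 'a set \<Rightarrow> 'a set" where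
  "Nbh V E X = {v\<in>V - X. \<exists>u\<in>X. E u v}"

definition plus_set :: "'a set \<Rightarrow> ('a \<Rightarrow> 'a \<Rightarrow> bool) \<Rightarrow> 'a set \<Rightarrow> 'a set" where
  "plus_set V E X = X \<union> Nbh V E X"

definition T_cut :: "'a set \<Rightarrow> ('a \<Rightarrow> 'a \<Rightarrow> bool) \<Rightarrow> 'a set \<Rightarrow> 'a set \<Rightarrow> bool" where
  "T_cut V E T X \<longleftrightarrow> X \<subseteq> T \<and> X \<noteq> {} \<and> T - plus_set V E X \<noteq> {}"

definition inner_nodes :: "'a list \<Rightarrow> 'a set" where
  "inner_nodes xs = set (butlast (tl xs))"

text \<open>\<open>T_path E T W xs\<close>: \<open>xs\<close> is a \<open>T\<close>-path of \<open>G[W]\<close>.\<close>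

definition T_path :: "('a \<Rightarrow> 'a \<Rightarrow> bool) \<Rightarrow> 'a set \<Rightarrow> 'a set \<Rightarrow> 'a list \<Rightarrow> bool" where
  "T_path E T W xs \<longleftrightarrow> path_in E W xs \<and> 2 \<le> length xs \<and>
     hd xs \<in> T \<and> last xs \<in> T \<and> inner_nodes xs \<inter> T = {}"

definition covers ::
  "'a set \<Rightarrow> ('a \<Rightarrow> 'a \<Rightarrow> bool) \<Rightarrow> 'a set \<Rightarrow> 'a list \<Rightarrow> 'a set \<Rightarrow> bool" where
  "covers V E T xs X \<longleftrightarrow>
     (hd xs \<in> X \<and> last xs \<in> T - plus_set V E X) \<or>
     (last xs \<in> X \<and> hd xs \<in> T - plus_set V E X)"

definition independent_in :: "('a \<Rightarrow> 'a \<Rightarrow> bool) \<Rightarrow> 'a set \<Rightarrow> 'a set \<Rightarrow> bool" where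
  "independent_in E W I \<longleftrightarrow> I \<subseteq> W \<and> (\<forall>u\<in>I. \<forall>v\<in>I. \<not> E u v)"

definition max_independent_in :: "('a \<Rightarrow> 'a \<Rightarrow> bool) \<Rightarrow> 'a set \<Rightarrow> 'a set \<Rightarrow> bool" where
  "max_independent_in E W I \<longleftrightarrow> independent_in E W I \<and>
     (\<forall>J. independent_in E W J \<and> I \<subseteq> J \<longrightarrow> J = I)"

text \<open>
  The algorithm is nondeterministic, so it is given by relations: the possible sets \<open>T\<close> computed
  in its first phase, the possible single iterations of the while loop (from \<open>S\<close> to \<open>S'\<close>, for a
  given \<open>T\<close>), and the possible outputs.
\<close>

definition shang_init :: "'a set \<Rightarrow> ('a \<Rightarrow> 'a \<Rightarrow> bool) \<Rightarrow> nat \<Rightarrow> 'a set \<Rightarrow> bool" where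
  "shang_init V E m T \<longleftrightarrow> (\<exists>I C.
     I 0 = {} \<and>
     (\<forall>i\<in>{1..m}. max_independent_in E (V - (\<Union>j\<in>{0..i - 1}. I j)) (I i)) \<and>
     C \<subseteq> V - I 1 \<and> card C \<le> card (I 1) \<and> conn E (C \<union> I 1) \<and>
     T = (\<Union>i\<in>{1..m}. I i) \<union> C)"

definition shang_step ::
  "'a set \<Rightarrow> ('a \<Rightarrow> 'a \<Rightarrow> bool) \<Rightarrow> 'a set \<Rightarrow> 'a set \<Rightarrow> 'a set \<Rightarrow> bool" where
  "shang_step V E T S S' \<longleftrightarrow> \<not> k_conn E 2 (T \<union> S) \<and> (\<exists>X P.
     T_cut V E T X \<and> card (Nbh V E X \<inter> T) = 1 \<and>
     \<not> (\<exists>Q. T_path E T (T \<union> S) Q \<and> covers V E T Q X) \<and>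
     T_path E T V P \<and> covers V E T P X \<and> card (inner_nodes P) \<le> 2 \<and>
     S' = S \<union> inner_nodes P)"

definition shang_output :: "'a set \<Rightarrow> ('a \<Rightarrow> 'a \<Rightarrow> bool) \<Rightarrow> nat \<Rightarrow> 'a set \<Rightarrow> bool" where
  "shang_output V E m A \<longleftrightarrow> (\<exists>T S.
     shang_init V E m T \<and> (shang_step V E T)\<^sup>*\<^sup>* {} S \<and> k_conn E 2 (T \<union> S) \<and> A = T \<union> S)"

text \<open>
  The algorithm always returns an output: the first phase can be carried out, and for each of its
  results the while loop neither runs forever nor gets stuck.
\<close>

definition shang_total :: "'a set \<Rightarrow> ('a \<Rightarrow> 'a \<Rightarrow> bool) \<Rightarrow> nat \<Rightarrow> bool" where
  "shang_total V E m \<longleftrightarrow>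
     (\<exists>T. shang_init V E m T) \<and>
     (\<forall>T. shang_init V E m T \<longrightarrow>
        \<not> (\<exists>f :: nat \<Rightarrow> 'a set. f 0 = {} \<and> (\<forall>n. shang_step V E T (f n) (f (Suc n)))) \<and>
        (\<forall>S. (shang_step V E T)\<^sup>*\<^sup>* {} S \<and> \<not> k_conn E 2 (T \<union> S) \<longrightarrow>
             (\<exists>S'. shang_step V E T S S')))"

end

theory Submission
  imports Defs
begin

text \<open>
  Let \<open>D\<close> be an optimal \<open>(2,m)\<close>-CDS. A node of a unit disk graph has at most 5 pairwise nonadjacent
  neighbours, so counting the edges between \<open>I\<^sub>i - D\<close> and \<open>D - I\<^sub>i\<close> gives
  \<open>m |I\<^sub>i - D| \<le> 5 |D - I\<^sub>i|\<close>. This bounds each \<open>|I\<^sub>i|\<close> by \<open>max (5/m) 1 |D|\<close> and, summed over the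
  disjoint layers, their union by \<open>5 |D|\<close> or \<open>(6 - 5/m) |D|\<close>.

  Every iteration of the loop merges two components of \<open>G[T \<union> S]\<close> minus \<open>v\<close>, where \<open>\<Gamma>\<^sub>T(X) = {v}\<close>;
  hence the number of iterations is at most the sum over \<open>v \<in> T\<close> of the number of components of
  \<open>G[T - {v}]\<close> minus one. Building \<open>T\<close> by inserting nodes one at a time into a connected set, this sum
  grows by at most 1, and not at all if the new node already has two neighbours. Nodes outside
  \<open>C \<union> I\<^sub>1 \<union> I\<^sub>2\<close> have a neighbour in \<open>I\<^sub>1\<close> and one in \<open>I\<^sub>2\<close>, so there are at most
  \<open>|C| + |I\<^sub>1| + |I\<^sub>2| \<le> 2 |I\<^sub>1| + |I\<^sub>2|\<close> iterations, each adding at most two nodes.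
\<close>

section \<open>Plane geometry: points of a unit disk with pairwise distances above 1\<close>

text \<open>By the law of cosines and cos (pi / 3) = 1 / 2, the squared distance is at most r^2 +
  s^2 - r * s for the two norms r and s, and this is at most the square of the larger norm.\<close>

lemma dist_le_1_if_Arg_close:
  fixes a b :: complex
  assumes "norm a \<le> 1" "norm b \<le> 1" "\<bar>Arg a - Arg b\<bar> \<le> pi / 3"
  shows "dist a b \<le> 1"
proof -
  let ?r = "norm a" and ?s = "norm b"
  have "cos (pi / 3) \<le> cos \<bar>Arg a - Arg b\<bar>"
    using assms(3) by (intro cos_monotone_0_pi_le) auto
  then have cos: "1 / 2 \<le> cos (Arg a - Arg b)"
    by (simp add: cos_60)
  have a: "a = rcis ?r (Arg a)" and b: "b = rcis ?s (Arg b)"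
    by (simp_all add: rcis_cmod_Arg)
  have re_im: "Re a = ?r * cos (Arg a)" "Im a = ?r * sin (Arg a)"
    "Re b = ?s * cos (Arg b)" "Im b = ?s * sin (Arg b)"
    by (metis a Re_rcis, metis a Im_rcis, metis b Re_rcis, metis b Im_rcis)
  have "(dist a b)\<^sup>2 = (Re a - Re b)\<^sup>2 + (Im a - Im b)\<^sup>2"
    by (simp add: dist_norm cmod_power2)
  also have "\<dots> = ((Re a)\<^sup>2 + (Im a)\<^sup>2) + ((Re b)\<^sup>2 + (Im b)\<^sup>2) - 2 * (Re a * Re b + Im a * Im b)"
    by (simp add: power2_eq_square algebra_simps)
  also have "\<dots> = ?r\<^sup>2 + ?s\<^sup>2 - 2 * (Re a * Re b + Im a * Im b)"
    by (simp add: cmod_power2)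
  also have "Re a * Re b + Im a * Im b = ?r * ?s * cos (Arg a - Arg b)"
    by (simp add: re_im cos_diff algebra_simps)
  also have "?r\<^sup>2 + ?s\<^sup>2 - 2 * (?r * ?s * cos (Arg a - Arg b)) \<le> ?r\<^sup>2 + ?s\<^sup>2 - ?r * ?s"
    using mult_left_mono[OF cos, of "?r * ?s"] by simp
  also have "\<dots> \<le> 1"
  proof (cases "?r \<le> ?s")
    case True
    then have "?r * ?r \<le> ?r * ?s" by (intro mult_left_mono) auto
    moreover have "?s * ?s \<le> 1" using assms(2) by (simp add: mult_le_one)
    ultimately show ?thesis by (simp add: power2_eq_square)
  next
    case False
    then have "?s * ?s \<le> ?r * ?s" by (intro mult_right_mono) auto
    moreover have "?r * ?r \<le> 1" using assms(1) by (simp add: mult_le_one)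
    ultimately show ?thesis by (simp add: power2_eq_square)
  qed
  finally show ?thesis
    by (simp add: abs_square_le_1)
qed

text \<open>After rotating one point to argument 0, all others lie outside the sector
  \<open>\<bar>Arg\<bar> \<le> pi / 3\<close>, which leaves room for four sectors of angle \<open>pi / 3\<close>.\<close>

lemma card_separated_unit_disk_complex:
  fixes A :: "complex set"
  assumes "\<And>a. a \<in> A \<Longrightarrow> norm a \<le> 1"
    and sep: "\<And>a b. a \<in> A \<Longrightarrow> b \<in> A \<Longrightarrow> a \<noteq> b \<Longrightarrow> dist a b > 1"
  shows "card A \<le> 5"
\<comment> \<open>The rotation used below needs a nonzero point, since
  \<open>sgn 0 = 0\<close>.\<close>
proof (cases "\<exists>x\<in>A. x \<noteq> 0")
  case False
  then have "A \<subseteq> {0}" by auto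
  then have "card A \<le> card {0 :: complex}" by (intro card_mono) auto
  then show ?thesis by simp
next
  case True
  then obtain x where x: "x \<in> A" "x \<noteq> 0" by blast
  \<comment> \<open>Multiplying by the conjugate of a unit number is the rotation that takes
    \<open>x\<close> to the positive real axis.\<close>
  define f where "f w = w * cnj (sgn x)" for w
  have nf: "norm (f w) = norm w" for w
    using x by (simp add: f_def norm_mult norm_sgn)
  have "f u - f w = f (u - w)" for u w
    by (simp add: f_def algebra_simps)
  then have df: "dist (f u) (f w) = dist u w" for u w
    by (metis nf dist_norm)
  have "f x = x * cnj x / of_real (norm x)"
    by (simp add: f_def sgn_eq)
  also have "\<dots> = of_real (norm x)"
    using x by (simp add: power2_eq_square flip: complex_norm_square)
  finally have "f x = of_real (norm x)" .
  then have Arg_x: "Arg (f x) = 0"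
    by (simp add: Arg_of_real)
  have far: "\<bar>Arg (f u) - Arg (f w)\<bar> > pi / 3" if "u \<in> A" "w \<in> A" "u \<noteq> w" for u w
    using dist_le_1_if_Arg_close[of "f u" "f w"] that assms[of u] assms[of w] sep[of u w] df nf
    by force
  \<comment> \<open>No thresholds at pi / 3 and - pi / 3 are needed: every point other than
    \<open>x\<close> has argument above pi / 3 in absolute value, so each class lies in an interval
    of length pi / 3, which cannot contain the arguments of two separated points.\<close>
  define s :: "complex \<Rightarrow> nat" where
    "s w = (let t = Arg (f w) in
      if t > 2 * pi / 3 then 0 else if t > 0 then 1 else if t > - 2 * pi / 3 then 2 else 3)" for w
  have "inj_on s (A - {x})"
  proof (rule inj_onI, rule ccontr)
    fix u w assume uw: "u \<in> A - {x}" "w \<in> A - {x}" "s u = s w" "u \<noteq> w"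
    have "\<bar>Arg (f u)\<bar> > pi / 3" "\<bar>Arg (f w)\<bar> > pi / 3"
      using far[of u x] far[of w x] uw x Arg_x by auto
    moreover have "\<bar>Arg (f u) - Arg (f w)\<bar> > pi / 3" using far uw by blast
    moreover note Arg_bounded[of "f u"] Arg_bounded[of "f w"] uw(3)
    ultimately show False
      by (auto simp: s_def Let_def abs_if split: if_splits)
  qed
  moreover have "s ` (A - {x}) \<subseteq> {0, 1, 2, 3}"
    by (auto simp: s_def Let_def)
  ultimately have "card (A - {x}) \<le> card {0, 1, 2, 3 :: nat}"
    by (intro card_inj_on_le) auto
  then show ?thesis
    by (simp add: card_Diff_singleton x)
qed

text \<open>Moving \<open>c\<close> to the origin and reading the coordinates as real and imaginary
  part is an isometry to the complex plane, where arguments are available.\<close>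

lemma card_separated_unit_disk:
  fixes A :: "(real^2) set"
  assumes near: "\<And>a. a \<in> A \<Longrightarrow> dist c a \<le> 1"
    and sep: "\<And>a b. a \<in> A \<Longrightarrow> b \<in> A \<Longrightarrow> a \<noteq> b \<Longrightarrow> dist a b > 1"
  shows "card A \<le> 5"
proof -
  define g where "g a = Complex (a $ 1 - c $ 1) (a $ 2 - c $ 2)" for a :: "real^2"
  have dist_g: "dist (g a) (g b) = dist a b" for a b
    by (simp add: g_def dist_norm norm_vec_def L2_set_def sum_2 complex_diff cmod_def)
  have "g c = 0" by (simp add: g_def complex_eq_iff)
  then have norm_g: "norm (g a) = dist c a" for a
    by (metis dist_g dist_0_norm)
  have "inj g" by (metis dist_g dist_eq_0_iff injI)
  then have "card A = card (g ` A)"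
    by (metis card_image inj_on_subset subset_UNIV)
  also have "\<dots> \<le> 5"
    by (rule card_separated_unit_disk_complex) (use near sep in \<open>auto simp: norm_g dist_g intro: sep\<close>)
  finally show ?thesis .
qed

section \<open>Image sizes of two maps, one finer than the other\<close>

text \<open>On \<open>A\<close> the map \<open>g\<close> factors through \<open>f\<close>. Below,
  \<open>f\<close> and \<open>g\<close> send a node to its reachability class in a smaller and in a
  larger node set.\<close>

lemma card_image_factor_le:
  assumes "finite A" and "\<And>a b. a \<in> A \<Longrightarrow> b \<in> A \<Longrightarrow> f a = f b \<Longrightarrow> g a = g b"
  shows "card (g ` A) \<le> card (f ` A)"
proof -
  have "g a = g (inv_into A f (f a))" if "a \<in> A" for a
    using that assms(2)[of a "inv_into A f (f a)"]
    by (metis f_inv_into_f imageI inv_into_into)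
  then have "g ` A \<subseteq> (\<lambda>y. g (inv_into A f y)) ` f ` A" by auto
  then show ?thesis
    using assms(1) by (meson card_image_le card_mono finite_imageI le_trans)
qed

text \<open>The factor map from the image of \<open>f\<close> onto the image of \<open>g\<close>
  identifies \<open>f x\<close> with \<open>f y\<close>, so it is not injective.\<close>

lemma card_image_factor_less:
  assumes "finite A" and fg: "\<And>a b. a \<in> A \<Longrightarrow> b \<in> A \<Longrightarrow> f a = f b \<Longrightarrow> g a = g b"
    and "x \<in> A" "y \<in> A" "f x \<noteq> f y" "g x = g y"
  shows "card (g ` A) < card (f ` A)"
proof -
  define h where "h z = g (inv_into A f z)" for z
  have h: "h (f a) = g a" if "a \<in> A" for a
    unfolding h_def using that fg[of a "inv_into A f (f a)"]
    by (metis f_inv_into_f imageI inv_into_into)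
  then have im: "g ` A = h ` f ` A" by (force simp: image_image)
  have "\<not> inj_on h (f ` A)"
    using assms(3-6) h by (auto simp: inj_on_def)
  then have "card (h ` f ` A) \<noteq> card (f ` A)"
    using eq_card_imp_inj_on assms(1) by blast
  then show ?thesis
    using im card_image_le[of "f ` A" h] assms(1) by simp
qed

section \<open>Reachability, connectedness and 2-connectedness\<close>

text \<open>A closure supports induction better than the distinct lists in \<open>conn\<close>. It
  is reflexive outside \<open>W\<close> too, so membership in \<open>W\<close> must be assumed where
  a path is extracted.\<close>

definition reach :: "('a \<Rightarrow> 'a \<Rightarrow> bool) \<Rightarrow> 'a set \<Rightarrow> 'a \<Rightarrow> 'a \<Rightarrow> bool" where
  "reach E W = (\<lambda>a b. a \<in> W \<and> b \<in> W \<and> E a b)\<^sup>*\<^sup>*"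

lemma reach_refl [simp]: "reach E W a a"
  by (simp add: reach_def)

lemma reach_trans: "reach E W a b \<Longrightarrow> reach E W b c \<Longrightarrow> reach E W a c"
  by (simp add: reach_def)

lemma reach_edge: "a \<in> W \<Longrightarrow> b \<in> W \<Longrightarrow> E a b \<Longrightarrow> reach E W a b"
  by (simp add: reach_def r_into_rtranclp)

lemma reach_mono: "reach E W a b \<Longrightarrow> W \<subseteq> W' \<Longrightarrow> reach E W' a b"
  unfolding reach_def by (erule rtranclp_mono[THEN predicate2D, rotated]) auto

lemma reach_sym:
  assumes "symp E" "reach E W a b"
  shows "reach E W b a"
  using assms(2) unfolding reach_def
  by (induction rule: rtranclp_induct)
     (auto intro: converse_rtranclp_into_rtranclp sympD[OF assms(1)])

lemma reach_closed:
  assumes "reach E W a b" "a \<in> K" "\<And>u v. u \<in> K \<Longrightarrow> u \<in> W \<Longrightarrow> v \<in> W \<Longrightarrow> E u v \<Longrightarrow> v \<in> K"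
  shows "b \<in> K"
  using assms(1,2) unfolding reach_def by (induction rule: rtranclp_induct) (auto intro: assms(3))

lemma reach_if_successively:
  "xs \<noteq> [] \<Longrightarrow> successively E xs \<Longrightarrow> set xs \<subseteq> W \<Longrightarrow> reach E W (hd xs) (last xs)"
proof (induction xs rule: induct_list012)
  case (3 x y zs)
  then show ?case
    using reach_trans[OF reach_edge[of x W y E], of "last (y # zs)"] by auto
qed auto

lemma path_in_if_reach:
  assumes "reach E W a b" "b \<in> W"
  shows "\<exists>xs. path_in E W xs \<and> hd xs = a \<and> last xs = b"
  using assms(1) unfolding reach_def
proof (induction rule: converse_rtranclp_induct)
  case base
  show ?case by (rule exI[of _ "[b]"]) (simp add: path_in_def assms)
next
  case (step a c)
  then obtain xs where xs: "path_in E W xs" "hd xs = c" "last xs = b" by blast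
  show ?case
  \<comment> \<open>If \<open>a\<close> is already on the path, the suffix starting at
    \<open>a\<close> keeps the nodes distinct.\<close>
  proof (cases "a \<in> set xs")
    case True
    then obtain ys zs where "xs = ys @ a # zs" by (metis split_list)
    then show ?thesis
      using xs by (intro exI[of _ "a # zs"]) (auto simp: path_in_def successively_append_iff)
  next
    case False
    then show ?thesis
      using xs step by (intro exI[of _ "a # xs"]) (auto simp: path_in_def successively_Cons)
  qed
qed

lemma conn_iff_reach: "conn E X \<longleftrightarrow> (\<forall>u\<in>X. \<forall>v\<in>X. reach E X u v)"
  unfolding conn_def
  by (metis path_in_def path_in_if_reach reach_if_successively)

text \<open>Otherwise \<open>K\<close> would be closed under the edges of G[X], and nothing outside
  it could be reached from \<open>u\<close>.\<close>

lemma conn_crossing_edge: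
  assumes "conn E X" "u \<in> X" "v \<in> X" "u \<in> K" "v \<notin> K"
  shows "\<exists>a b. a \<in> X \<inter> K \<and> b \<in> X - K \<and> E a b"
proof (rule ccontr)
  assume "\<not> ?thesis"
  then have "v \<in> K"
    using reach_closed[of E X u v K] assms by (auto simp: conn_iff_reach)
  then show False using assms by simp
qed

lemma conn_Un_dominated:
  assumes "symp E" "conn E X" "\<And>y. y \<in> Y \<Longrightarrow> \<exists>x\<in>X. E y x"
  shows "conn E (X \<union> Y)"
  unfolding conn_iff_reach
proof (intro ballI)
  have "\<exists>x\<in>X. reach E (X \<union> Y) u x" if "u \<in> X \<union> Y" for u
    using that assms(3)[of u] by (metis UnCI UnE reach_edge reach_refl)
  moreover have "reach E (X \<union> Y) x x'" if "x \<in> X" "x' \<in> X" for x x'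
    using that assms(2) by (auto simp: conn_iff_reach intro: reach_mono)
  moreover fix u v assume "u \<in> X \<union> Y" "v \<in> X \<union> Y"
  ultimately show "reach E (X \<union> Y) u v"
    by (meson reach_sym[OF assms(1)] reach_trans)
qed

text \<open>A removable set is empty or a singleton. The convention on small complete graphs agrees
  with this, because induced subgraphs of complete graphs are connected.\<close>

lemma k_conn_2_iff:
  assumes "finite X"
  shows "k_conn E 2 X \<longleftrightarrow> conn E X \<and> (\<forall>v\<in>X. conn E (X - {v}))"
proof
  assume "k_conn E 2 X"
  then consider "\<forall>R\<subseteq>X. card R \<le> 1 \<longrightarrow> conn E (X - R)" | "complete_on E X" "card X \<le> 2"
    by (auto simp: k_conn_def)
  then show "conn E X \<and> (\<forall>v\<in>X. conn E (X - {v}))"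
  proof cases
    case 1
    then show ?thesis using 1[rule_format, of "{}"] by simp
  next
    case 2
    then have "conn E Y" if "Y \<subseteq> X" for Y
      using that unfolding conn_iff_reach complete_on_def by (metis reach_edge reach_refl subsetD)
    then show ?thesis by auto
  qed
next
  assume *: "conn E X \<and> (\<forall>v\<in>X. conn E (X - {v}))"
  have "conn E (X - R)" if R: "R \<subseteq> X" "card R \<le> 1" for R
  proof (cases "R = {}")
    case False
    then have "card R = 1"
      using R assms by (metis One_nat_def card_gt_0_iff finite_subset le_antisym Suc_leI)
    then obtain v where "R = {v}" by (rule card_1_singletonE)
    then show ?thesis using * R by auto
  qed (use * in auto)
  then show "k_conn E 2 X" by (simp add: k_conn_def)
qed

section \<open>Counting components\<close>

text \<open>For \<open>A\<close> inside \<open>W\<close> this counts the components of G[W] that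
  meet \<open>A\<close>. With \<open>A\<close> kept separate from \<open>W\<close>, the count can
  only drop when \<open>W\<close> grows, as new nodes are never counted themselves.\<close>

definition reach_classes :: "('a \<Rightarrow> 'a \<Rightarrow> bool) \<Rightarrow> 'a set \<Rightarrow> 'a set \<Rightarrow> nat" where
  "reach_classes E W A = card ((\<lambda>a. Collect (reach E W a)) ` A)"

lemma Collect_reach_eq_iff:
  assumes "symp E"
  shows "Collect (reach E W a) = Collect (reach E W b) \<longleftrightarrow> reach E W a b"
proof
  show "reach E W a b" if "Collect (reach E W a) = Collect (reach E W b)"
    using that by (metis mem_Collect_eq reach_refl)
  show "Collect (reach E W a) = Collect (reach E W b)" if "reach E W a b"
    using that reach_sym[OF assms that] by (auto intro: reach_trans)
qed

lemma reach_classes_antimono: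
  assumes "symp E" "finite A" "W \<subseteq> W'"
  shows "reach_classes E W' A \<le> reach_classes E W A"
  unfolding reach_classes_def
  by (rule card_image_factor_le)
     (use assms in \<open>auto simp: Collect_reach_eq_iff intro: reach_mono\<close>)

lemma reach_classes_less:
  assumes "symp E" "finite A" "W \<subseteq> W'" "a \<in> A" "b \<in> A" "\<not> reach E W a b" "reach E W' a b"
  shows "reach_classes E W' A < reach_classes E W A"
  unfolding reach_classes_def
  by (rule card_image_factor_less[of _ _ _ a b])
     (use assms in \<open>auto simp: Collect_reach_eq_iff intro: reach_mono\<close>)

lemma reach_classes_pos: "finite A \<Longrightarrow> A \<noteq> {} \<Longrightarrow> 0 < reach_classes E W A"
  by (simp add: reach_classes_def card_gt_0_iff)

lemma reach_classes_insert:
  assumes "symp E" "finite W"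
  shows "reach_classes E (insert z W) (insert z W) \<le> Suc (reach_classes E W W)"
proof -
  have "reach_classes E (insert z W) (insert z W) \<le> Suc (reach_classes E (insert z W) W)"
    unfolding reach_classes_def image_insert by (rule card_insert_le_m1) auto
  also have "reach_classes E (insert z W) W \<le> reach_classes E W W"
    using assms by (intro reach_classes_antimono) auto
  finally show ?thesis by simp
qed

text \<open>The new node falls into the class of its neighbour \<open>w\<close>, so it contributes
  no class of its own.\<close>

lemma reach_classes_insert_adjacent:
  assumes "symp E" "finite W" "w \<in> W" "E z w"
  shows "reach_classes E (insert z W) (insert z W) \<le> reach_classes E W W"
proof -
  have "reach E (insert z W) z w" using assms by (intro reach_edge) auto
  then have "Collect (reach E (insert z W) z) = Collect (reach E (insert z W) w)"
    using assms by (simp add: Collect_reach_eq_iff)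
  then have "(\<lambda>a. Collect (reach E (insert z W) a)) ` insert z W =
    (\<lambda>a. Collect (reach E (insert z W) a)) ` W"
    using assms(3) by auto
  then show ?thesis
    using reach_classes_antimono[OF assms(1,2), of W "insert z W"]
    by (auto simp: reach_classes_def)
qed

lemma reach_classes_conn:
  assumes "symp E" "conn E W"
  shows "reach_classes E W W \<le> 1"
proof (cases "W = {}")
  case False
  then obtain w where "w \<in> W" by blast
  have "Collect (reach E W a) = Collect (reach E W w)" if "a \<in> W" for a
    using that \<open>w \<in> W\<close> assms by (simp add: conn_iff_reach Collect_reach_eq_iff)
  then have "(\<lambda>a. Collect (reach E W a)) ` W \<subseteq> {Collect (reach E W w)}"
    by auto
  then show ?thesis
    unfolding reach_classes_def using card_mono[of "{Collect (reach E W w)}"] by auto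
qed (simp add: reach_classes_def)

section \<open>The potential function of the loop\<close>

text \<open>If each node of \<open>S - T\<close> has two neighbours in \<open>T\<close>, the summand at \<open>v\<close> is the number of
  components of \<open>G[T \<union> S - {v}]\<close> minus one. Truncated subtraction matters only if \<open>T = {v}\<close>.\<close>

definition excess :: "('a \<Rightarrow> 'a \<Rightarrow> bool) \<Rightarrow> 'a set \<Rightarrow> 'a set \<Rightarrow> nat" where
  "excess E T S = (\<Sum>v\<in>T. reach_classes E (T \<union> S - {v}) (T - {v}) - 1)"

text \<open>The summand at \<open>z\<close> vanishes: deleting \<open>z\<close> leaves the connected
  set \<open>X\<close>, which has at most one class.\<close>

lemma excess_insert_eq:
  assumes "symp E" "finite X" "conn E X" "z \<notin> X"
  shows "excess E (insert z X) {} =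
    (\<Sum>v\<in>X. reach_classes E (insert z (X - {v})) (insert z (X - {v})) - 1)"
proof -
  have "insert z X - {v} = insert z (X - {v})" if "v \<in> X" for v
    using that assms(4) by auto
  moreover have "insert z X - {z} = X" using assms(4) by simp
  moreover have "reach_classes E X X - 1 = 0"
    using reach_classes_conn[OF assms(1,3)] by simp
  ultimately show ?thesis
    using assms by (simp add: excess_def)
qed

text \<open>The node \<open>z\<close> can form a new component only when its neighbour
  \<open>x\<close> is deleted, so only the summand at \<open>x\<close> may grow, and by at most
  1.\<close>

lemma excess_insert_one:
  assumes "symp E" "finite X" "conn E X" "z \<notin> X" "x \<in> X" "E z x"
  shows "excess E (insert z X) {} \<le> Suc (excess E X {})"
proof -
  let ?c = "\<lambda>W. reach_classes E W W"
  have "?c (insert z (X - {v})) - 1 \<le> (?c (X - {v}) - 1) + (if v = x then 1 else 0)" if "v \<in> X" for v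
    using reach_classes_insert[of E "X - {v}" z] reach_classes_insert_adjacent[of E "X - {v}" x z]
      assms that by (auto intro: diff_le_mono)
  then have "excess E (insert z X) {} \<le> (\<Sum>v\<in>X. (?c (X - {v}) - 1) + (if v = x then 1 else 0))"
    unfolding excess_insert_eq[OF assms(1-4)] by (rule sum_mono)
  also have "\<dots> = Suc (excess E X {})"
    using assms by (simp add: excess_def sum.distrib)
  finally show ?thesis .
qed

text \<open>Whichever node is deleted, \<open>z\<close> keeps one of its neighbours \<open>x\<close>
  and \<open>y\<close>, so no summand grows.\<close>

lemma excess_insert_two:
  assumes "symp E" "finite X" "conn E X" "z \<notin> X"
    and "x \<in> X" "E z x" "y \<in> X" "E z y" "x \<noteq> y"
  shows "excess E (insert z X) {} \<le> excess E X {}"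
proof -
  let ?c = "\<lambda>W. reach_classes E W W"
  have "?c (insert z (X - {v})) - 1 \<le> ?c (X - {v}) - 1" if "v \<in> X" for v
  proof -
    obtain w where "w \<in> X - {v}" "E z w" using assms by blast
    then show ?thesis
      using reach_classes_insert_adjacent[of E "X - {v}" w z] assms by (auto intro: diff_le_mono)
  qed
  then show ?thesis
    unfolding excess_insert_eq[OF assms(1-4)] unfolding excess_def Un_empty_right by (rule sum_mono)
qed

text \<open>Connected subsets of \<open>X\<close> are grown one node at a time along crossing edges,
  each insertion costing at most 1 by \<open>excess_insert_one\<close>; the subset of full size is
  \<open>X\<close>.\<close>

lemma excess_le_card:
  assumes "symp E" "finite X" "conn E X"
  shows "excess E X {} \<le> card X"
proof -
  have "n \<le> card X \<Longrightarrow> \<exists>Y\<subseteq>X. card Y = n \<and> conn E Y \<and> excess E Y {} \<le> n" for n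
  proof (induction n)
    case 0
    show ?case by (rule exI[of _ "{}"]) (simp add: conn_def excess_def)
  next
    case (Suc n)
    then obtain Y where Y: "Y \<subseteq> X" "card Y = n" "conn E Y" "excess E Y {} \<le> n" by auto
    have "finite Y" using Y assms finite_subset by blast
    have "Y \<noteq> X" using Y Suc.prems by auto
    then obtain z' where z': "z' \<in> X" "z' \<notin> Y" using Y by blast
    show ?case
    proof (cases "Y = {}")
      case True
      \<comment> \<open>The only summand counts the classes of the empty set, and 0 - 1 is 0 in
        \<open>nat\<close>.\<close>
      have "excess E {z'} {} = 0" by (simp add: excess_def reach_classes_def)
      with True z' Y(2) show ?thesis
        by (intro exI[of _ "{z'}"]) (auto simp: conn_iff_reach)
    next
      case False
      then obtain y where "y \<in> Y" by blast
      with z' Y assms(3) obtain a z where az: "a \<in> X \<inter> Y" "z \<in> X - Y" "E a z"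
        using conn_crossing_edge[of E X y z' Y] by auto
      have "E z a" using az assms(1) by (metis sympD)
      have "conn E (insert z Y)"
        using conn_Un_dominated[OF assms(1) Y(3), of "{z}"] az \<open>E z a\<close> by auto
      moreover have "excess E (insert z Y) {} \<le> Suc n"
        using excess_insert_one[OF assms(1) \<open>finite Y\<close> Y(3), of z a] az \<open>E z a\<close> Y(4) by auto
      ultimately show ?thesis
        using az Y \<open>finite Y\<close> by (intro exI[of _ "insert z Y"]) auto
    qed
  qed
  from this[of "card X"] show ?thesis
    using assms(2) by (metis card_subset_eq order_refl)
qed

text \<open>The nodes of \<open>Y\<close> are inserted one by one with
  \<open>excess_insert_two\<close>; each intermediate set is connected because it is dominated by
  \<open>X\<close>.\<close>

lemma excess_Un_le:
  assumes "symp E" "finite X" "conn E X" "finite Y"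
    and "\<And>z. z \<in> Y \<Longrightarrow> \<exists>x\<in>X. \<exists>y\<in>X. x \<noteq> y \<and> E z x \<and> E z y"
  shows "excess E (X \<union> Y) {} \<le> excess E X {}"
  using assms(4,5)
proof (induction Y rule: finite_induct)
  case (insert z Y)
  have "conn E (X \<union> Y)"
    using insert.prems by (intro conn_Un_dominated[OF assms(1,3)]) blast
  show ?case
  proof (cases "z \<in> X")
    case True
    then show ?thesis using insert by (simp add: insert_absorb)
  next
    case False
    obtain x y where "x \<in> X" "y \<in> X" "x \<noteq> y" "E z x" "E z y" using insert.prems by blast
    then have "excess E (insert z (X \<union> Y)) {} \<le> excess E (X \<union> Y) {}"
      using insert.hyps False assms(2) \<open>conn E (X \<union> Y)\<close>
      by (intro excess_insert_two[OF assms(1), of _ z x y]) auto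
    then show ?thesis using insert by auto
  qed
qed simp

section \<open>Effect of one loop iteration and termination\<close>

locale finite_graph =
  fixes V :: "'a set" and E :: "'a \<Rightarrow> 'a \<Rightarrow> bool"
  assumes simple: "simple_graph V E"
begin

lemma finite_V: "finite V"
  using simple by (simp add: simple_graph_def)

lemma symp_E: "symp E"
  using simple by (auto simp: simple_graph_def symp_def)

lemma E_sym: "E u v \<Longrightarrow> E v u"
  using symp_E by (rule sympD)

lemma E_irrefl: "\<not> E u u"
  using simple by (auto simp: simple_graph_def)

lemma E_in_V: "E u v \<Longrightarrow> u \<in> V" "E u v \<Longrightarrow> v \<in> V"
  using simple by (auto simp: simple_graph_def)

lemma set_path_inner:
  "2 \<le> length P \<Longrightarrow> set P = {hd P, last P} \<union> inner_nodes P"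
  by (cases P; cases "tl P" rule: rev_cases) (auto simp: inner_nodes_def)

text \<open>Cut the path after its last node in \<open>X\<close> and at the next node in \<open>T\<close>.\<close>

lemma covering_T_path_if_reach:
  assumes "reach E (T \<union> S - {v}) x y" "x \<in> X" "y \<in> T - X - {v}"
    and "X \<subseteq> T" "Nbh V E X \<inter> T \<subseteq> {v}"
  shows "\<exists>Q. T_path E T (T \<union> S) Q \<and> covers V E T Q X"
proof -
  obtain xs where xs: "path_in E (T \<union> S - {v}) xs" "hd xs = x" "last xs = y"
    using path_in_if_reach[OF assms(1)] assms(3) by auto
  then have "\<exists>a\<in>set xs. a \<in> X"
    using assms(2) by (metis hd_in_set path_in_def)
  then obtain as a bs where split: "xs = as @ a # bs" "a \<in> X" "\<forall>b\<in>set bs. b \<notin> X"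
    using split_list_last_prop[of xs "\<lambda>a. a \<in> X"] by blast
  have "bs \<noteq> []" using split xs(3) assms(3) by auto
  then have "y \<in> set bs" using split xs(3) by auto
  then have "\<exists>t\<in>set bs. t \<in> T" using assms(3) by auto
  then obtain cs t ds where split2: "bs = cs @ t # ds" "t \<in> T" "\<forall>c\<in>set cs. c \<notin> T"
    using split_list_first_prop[of bs "\<lambda>t. t \<in> T"] by blast
  let ?Q = "a # cs @ [t]"
  have path: "path_in E (T \<union> S - {v}) (as @ ?Q @ ds)" using xs(1) split split2 by simp
  then have "successively E (?Q @ ds)" "distinct ?Q" "set ?Q \<subseteq> T \<union> S"
    by (auto simp: path_in_def successively_append_iff)
  moreover from this(1) have "successively E ?Q" by (simp only: successively_append_iff)
  ultimately have "T_path E T (T \<union> S) ?Q"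
    unfolding T_path_def path_in_def inner_nodes_def using split(2) split2(2,3) assms(4) by auto
  \<comment> \<open>The path avoids \<open>v\<close>, the only node of \<open>T\<close> adjacent to
    \<open>X\<close> from outside, so \<open>t\<close> lies beyond the closed neighbourhood of
    \<open>X\<close>.\<close>
  moreover have "t \<notin> X" "t \<noteq> v" using path split(3) split2(1) by (auto simp: path_in_def)
  then have "covers V E T ?Q X"
    using split(2) split2(2) assms(5) by (auto simp: covers_def plus_set_def)
  ultimately show ?thesis by blast
qed

lemma shang_step_subset_V: "shang_step V E T S S' \<Longrightarrow> S \<subseteq> V \<Longrightarrow> S' \<subseteq> V"
  by (auto simp: shang_step_def T_path_def path_in_def inner_nodes_def)
     (meson in_set_butlastD list.set_sel(2) subsetD)

lemma card_shang_step: "shang_step V E T S S' \<Longrightarrow> card S' \<le> card S + 2"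
  unfolding shang_step_def by (meson add_left_mono card_Un_le le_trans)

text \<open>With \<open>v\<close> the single neighbour of \<open>X\<close> in \<open>T\<close>, the
  ends of \<open>P\<close> were separated in G[T] plus \<open>S\<close> minus \<open>v\<close>,
  since otherwise a covering \<open>T\<close>-path would already exist. Adding \<open>P\<close>
  joins them, so the summand at \<open>v\<close> drops; the other summands cannot grow because
  \<open>S\<close> only grows.\<close>

lemma excess_shang_step:
  assumes "shang_step V E T S S'" "T \<subseteq> V"
  shows "excess E T S' < excess E T S"
proof -
  obtain X P where X: "T_cut V E T X" "card (Nbh V E X \<inter> T) = 1"
    and uncovered: "\<not> (\<exists>Q. T_path E T (T \<union> S) Q \<and> covers V E T Q X)"
    and P: "T_path E T V P" "covers V E T P X"
    and S': "S' = S \<union> inner_nodes P"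
    using assms(1) unfolding shang_step_def by blast
  obtain v where v: "Nbh V E X \<inter> T = {v}" using X(2) by (rule card_1_singletonE)
  have "finite T" using assms(2) finite_V finite_subset by blast
  have "X \<subseteq> T" using X(1) by (simp add: T_cut_def)
  have "v \<notin> X" "v \<in> T" "v \<in> plus_set V E X"
    using v by (auto simp: Nbh_def plus_set_def)
  have P': "2 \<le> length P" "P \<noteq> []" "successively E P" "inner_nodes P \<inter> T = {}"
    using P(1) by (auto simp: T_path_def path_in_def)
  have ends: "hd P \<in> X \<and> last P \<in> T - X - {v} \<or> last P \<in> X \<and> hd P \<in> T - X - {v}"
    using P(2) \<open>v \<in> plus_set V E X\<close> by (auto simp: covers_def plus_set_def)
  then have PT: "hd P \<in> T - {v}" "last P \<in> T - {v}"
    using \<open>X \<subseteq> T\<close> \<open>v \<notin> X\<close> by auto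
  \<comment> \<open>The ends of \<open>P\<close> differ from \<open>v\<close> because
    \<open>P\<close> covers \<open>X\<close>, and its inner nodes lie outside \<open>T\<close>,
    which contains \<open>v\<close>.\<close>
  have "set P \<subseteq> T \<union> S' - {v}"
    using set_path_inner[OF P'(1)] PT S' P'(4) \<open>v \<in> T\<close> by auto
  then have "reach E (T \<union> S' - {v}) (hd P) (last P)"
    using P' by (intro reach_if_successively)
  moreover have "\<not> reach E (T \<union> S - {v}) (hd P) (last P)"
    using ends uncovered covering_T_path_if_reach[of T S v _ _ X] reach_sym[OF symp_E]
      \<open>X \<subseteq> T\<close> v by (metis order_refl)
  ultimately have less: "reach_classes E (T \<union> S' - {v}) (T - {v}) < reach_classes E (T \<union> S - {v}) (T - {v})"
    using PT S' \<open>finite T\<close> by (intro reach_classes_less[OF symp_E]) auto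
  \<comment> \<open>Positivity keeps the inequality strict after the truncated subtraction of
    1.\<close>
  moreover have "0 < reach_classes E (T \<union> S' - {v}) (T - {v})"
    using PT \<open>finite T\<close> by (intro reach_classes_pos) auto
  ultimately have "reach_classes E (T \<union> S' - {v}) (T - {v}) - 1 < reach_classes E (T \<union> S - {v}) (T - {v}) - 1"
    by linarith
  moreover have "reach_classes E (T \<union> S' - {u}) (T - {u}) - 1 \<le> reach_classes E (T \<union> S - {u}) (T - {u}) - 1" for u
    using \<open>finite T\<close> S' by (intro diff_le_mono reach_classes_antimono[OF symp_E]) auto
  ultimately show ?thesis
    unfolding excess_def using \<open>finite T\<close> \<open>v \<in> T\<close>
    by (intro sum_strict_mono_ex1) auto
qed

text \<open>An invariant: each iteration adds at most two nodes and lowers the excess by at least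
  1.\<close>

lemma shang_run:
  assumes "(shang_step V E T)\<^sup>*\<^sup>* {} S" "T \<subseteq> V"
  shows "S \<subseteq> V" "card S + 2 * excess E T S \<le> 2 * excess E T {}"
proof -
  have "S \<subseteq> V \<and> card S + 2 * excess E T S \<le> 2 * excess E T {}"
    using assms(1)
  proof (induction rule: rtranclp_induct)
    case (step S S')
    then show ?case
      using shang_step_subset_V[of T S S'] card_shang_step[of T S S'] excess_shang_step[OF _ assms(2), of S S']
      by auto
  qed simp
  then show "S \<subseteq> V" "card S + 2 * excess E T S \<le> 2 * excess E T {}" by auto
qed

lemma shang_loop_terminates:
  assumes "T \<subseteq> V"
  shows "\<not> (\<exists>f :: nat \<Rightarrow> 'a set. f 0 = {} \<and> (\<forall>n. shang_step V E T (f n) (f (Suc n))))"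
proof
  assume "\<exists>f :: nat \<Rightarrow> 'a set. f 0 = {} \<and> (\<forall>n. shang_step V E T (f n) (f (Suc n)))"
  then obtain f :: "nat \<Rightarrow> 'a set" where f: "\<And>n. shang_step V E T (f n) (f (Suc n))" by blast
  have "wf (Wellfounded.measure (excess E T))" by simp
  moreover have "(f (Suc n), f n) \<in> Wellfounded.measure (excess E T)" for n
    using excess_shang_step[OF f assms] by simp
  ultimately show False by (meson wf_iff_no_infinite_down_chain)
qed

section \<open>The loop never gets stuck\<close>

lemma two_neighbours:
  assumes "2 \<le> card {u \<in> X. E v u}"
  shows "\<exists>x\<in>X. \<exists>y\<in>X. x \<noteq> y \<and> E v x \<and> E v y"
proof -
  obtain x where x: "x \<in> {u \<in> X. E v u}"
    using assms by (metis card.empty ex_in_conv not_numeral_le_zero)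
  have "\<not> {u \<in> X. E v u} \<subseteq> {x}"
    using card_mono[of "{x}" "{u \<in> X. E v u}"] assms by auto
  with x show ?thesis by blast
qed

text \<open>After the deletion of any single node, each remaining node of \<open>Y\<close> still has
  a neighbour in what is left of \<open>X\<close>.\<close>

lemma k_conn_2_Un_dominated:
  assumes "X \<subseteq> V" "Y \<subseteq> V" "k_conn E 2 X"
    and dom: "\<And>y. y \<in> Y \<Longrightarrow> \<exists>a\<in>X. \<exists>b\<in>X. a \<noteq> b \<and> E y a \<and> E y b"
  shows "k_conn E 2 (X \<union> Y)"
proof -
  have fin: "finite X" "finite (X \<union> Y)" using assms finite_V finite_subset by blast+
  have X: "conn E X" "\<And>v. v \<in> X \<Longrightarrow> conn E (X - {v})"
    using assms(3) by (auto simp: k_conn_2_iff[OF fin(1)])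
  have "conn E (X - {v} \<union> (Y - {v}))" for v
  proof (rule conn_Un_dominated[OF symp_E])
    show "conn E (X - {v})" using X by (cases "v \<in> X") auto
    show "\<exists>x\<in>X - {v}. E y x" if "y \<in> Y - {v}" for y
      using dom[of y] that by auto
  qed
  moreover have "conn E (X \<union> Y)"
    using dom by (intro conn_Un_dominated[OF symp_E X(1)]) blast
  ultimately show ?thesis
    by (simp add: k_conn_2_iff[OF fin(2)] Un_Diff)
qed

text \<open>Some cut node \<open>v\<close> disconnects G[T] plus \<open>S\<close>, and
  \<open>X\<close> is the part in \<open>T\<close> of one component left by its deletion. A
  \<open>T\<close>-path covering \<open>X\<close> there would avoid \<open>v\<close> and leave that
  component.\<close>

lemma uncovered_cut_exists:
  assumes "T \<subseteq> V" "S \<subseteq> V" "conn E T"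
    and dom: "\<And>y. y \<in> V - T \<Longrightarrow> \<exists>a\<in>T. \<exists>b\<in>T. a \<noteq> b \<and> E y a \<and> E y b"
    and "\<not> k_conn E 2 (T \<union> S)"
  obtains X v where "X \<subseteq> T" "X \<noteq> {}" "Nbh V E X \<inter> T = {v}" "T - X - {v} \<noteq> {}"
    "\<not> (\<exists>Q. T_path E T (T \<union> S) Q \<and> covers V E T Q X)"
proof -
  let ?W = "T \<union> S"
  have "finite ?W" using assms(1,2) finite_V finite_subset by blast
  have "conn E ?W" using dom assms(2) conn_Un_dominated[OF symp_E assms(3), of "S - T"] by fastforce
  then obtain v where v: "v \<in> ?W" "\<not> conn E (?W - {v})"
    using assms(5) k_conn_2_iff[OF \<open>finite ?W\<close>] by blast
  \<comment> \<open>Deleting a node outside \<open>T\<close> leaves all of the connected set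
    \<open>T\<close>, which dominates the rest.\<close>
  have "v \<in> T"
  proof (rule ccontr)
    assume "v \<notin> T"
    then have "?W - {v} = T \<union> (S - T - {v})" by auto
    moreover have "conn E (T \<union> (S - T - {v}))"
      using dom assms(2) by (intro conn_Un_dominated[OF symp_E assms(3)]) blast
    ultimately show False using v by simp
  qed
  \<comment> \<open>Every component left after deleting \<open>v\<close> meets \<open>T\<close>: a
    node outside \<open>T\<close> has two neighbours in \<open>T\<close>, one of them different from
    \<open>v\<close>.\<close>
  have to_T: "\<exists>t\<in>T - {v}. reach E (?W - {v}) u t" if u: "u \<in> ?W - {v}" for u
  proof (cases "u \<in> T")
    case True
    then show ?thesis using u by (intro bexI[of _ u]) auto
  next
    case False
    then obtain t where "t \<in> T - {v}" "E u t" using dom[of u] u assms(2) by blast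
    then show ?thesis using u by (intro bexI[of _ t] reach_edge) auto
  qed
  obtain a b where ab: "a \<in> ?W - {v}" "b \<in> ?W - {v}" "\<not> reach E (?W - {v}) a b"
    using v(2) unfolding conn_iff_reach by blast
  obtain x y where x: "x \<in> T - {v}" "reach E (?W - {v}) a x"
    and y: "y \<in> T - {v}" "reach E (?W - {v}) b y"
    using to_T[OF ab(1)] to_T[OF ab(2)] by blast
  have xy: "\<not> reach E (?W - {v}) x y"
    using ab(3) x(2) y(2) by (meson reach_trans reach_sym[OF symp_E])
  define X where "X = {t \<in> T - {v}. reach E (?W - {v}) x t}"
  have "X \<subseteq> T" "x \<in> X" "y \<in> T - X - {v}" using x y xy by (auto simp: X_def)
  have "Nbh V E X \<inter> T \<subseteq> {v}"
  proof
    fix t assume t: "t \<in> Nbh V E X \<inter> T"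
    then obtain u where u: "u \<in> X" "E u t" by (auto simp: Nbh_def)
    have "t \<in> X" if "t \<noteq> v"
      using u t that by (auto simp: X_def intro: reach_trans reach_edge)
    then show "t \<in> {v}" using t by (auto simp: Nbh_def)
  qed
  \<comment> \<open>Since G[T] is connected, some edge leaves \<open>X\<close> within
    \<open>T\<close>.\<close>
  moreover have "Nbh V E X \<inter> T \<noteq> {}"
    using conn_crossing_edge[OF assms(3), of x y X] \<open>X \<subseteq> T\<close> \<open>x \<in> X\<close> \<open>y \<in> T - X - {v}\<close> assms(1)
    by (auto simp: Nbh_def)
  ultimately have N: "Nbh V E X \<inter> T = {v}" by auto
  have "\<not> (\<exists>Q. T_path E T ?W Q \<and> covers V E T Q X)"
  proof
    assume "\<exists>Q. T_path E T ?W Q \<and> covers V E T Q X"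
    then obtain Q where Q: "T_path E T ?W Q" "covers V E T Q X" by blast
    have ends: "hd Q \<in> X \<and> last Q \<in> T - X - {v} \<or> last Q \<in> X \<and> hd Q \<in> T - X - {v}"
      using Q(2) N by (auto simp: covers_def plus_set_def)
    have Q': "2 \<le> length Q" "Q \<noteq> []" "successively E Q" "set Q \<subseteq> ?W" "inner_nodes Q \<inter> T = {}"
      using Q(1) by (auto simp: T_path_def path_in_def)
    then have "set Q \<subseteq> ?W - {v}"
      using set_path_inner[OF Q'(1)] ends \<open>v \<in> T\<close> by (auto simp: X_def)
    then have "reach E (?W - {v}) (hd Q) (last Q)"
      using Q' by (intro reach_if_successively)
    moreover have "z \<in> X" if "w \<in> X" "reach E (?W - {v}) w z" "z \<in> T - X - {v}" for w z
      using that by (auto simp: X_def intro: reach_trans)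
    ultimately show False
      using ends reach_sym[OF symp_E] by blast
  qed
  then show thesis
    using that[of X v] \<open>X \<subseteq> T\<close> \<open>x \<in> X\<close> \<open>y \<in> T - X - {v}\<close> N by blast
qed

text \<open>An edge of G minus \<open>v\<close> that leaves \<open>X\<close> together with its
  neighbours outside \<open>T\<close> forms the middle of the path. Its first end is adjacent to
  \<open>X\<close>, and its second end is in \<open>T\<close> or has a neighbour in \<open>T\<close>
  other than \<open>v\<close>.\<close>

lemma short_covering_T_path_exists:
  assumes "T \<subseteq> V" "conn E (V - {v})" "X \<subseteq> T" "X \<noteq> {}" "Nbh V E X \<inter> T = {v}" "T - X - {v} \<noteq> {}"
    and dom: "\<And>y. y \<in> V - T \<Longrightarrow> \<exists>a\<in>T. \<exists>b\<in>T. a \<noteq> b \<and> E y a \<and> E y b"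
  shows "\<exists>P. T_path E T V P \<and> covers V E T P X \<and> card (inner_nodes P) \<le> 2"
proof -
  obtain x y where x: "x \<in> X" and y: "y \<in> T - X - {v}" using assms by blast
  have "v \<notin> X" "v \<in> T" using assms(5) by (auto simp: Nbh_def)
  define K where "K = X \<union> {z \<in> V - T. \<exists>u\<in>X. E u z}"
  have "x \<in> V - {v}" "y \<in> V - {v}" "x \<in> K" "y \<notin> K"
    using x y assms(1,3) \<open>v \<notin> X\<close> by (auto simp: K_def)
  then obtain a b where ab: "a \<in> (V - {v}) \<inter> K" "b \<in> V - {v} - K" "E a b"
    using conn_crossing_edge[OF assms(2)] by metis
  \<comment> \<open>A neighbour of \<open>X\<close> outside \<open>X\<close> either lies outside
    \<open>T\<close>, hence in \<open>K\<close>, or equals \<open>v\<close>; so \<open>b\<close>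
    cannot be one.\<close>
  have "a \<notin> X"
  proof
    assume "a \<in> X"
    then have "b \<in> Nbh V E X" using ab by (auto simp: Nbh_def K_def)
    then show False using ab \<open>a \<in> X\<close> assms(5) by (auto simp: K_def)
  qed
  then obtain u where u: "u \<in> X" "E u a" and a: "a \<in> V - T" using ab by (auto simp: K_def)
  have far: "w \<in> T - plus_set V E X" if "w \<in> T" "w \<notin> X" "w \<noteq> v" for w
    using that assms(5) by (auto simp: plus_set_def)
  show ?thesis
  proof (cases "b \<in> T")
    case True
    then have "b \<in> T - plus_set V E X" using far ab by (auto simp: K_def)
    moreover have "T_path E T V [u, a, b]"
      using u a ab True assms(1,3) by (auto simp: T_path_def path_in_def inner_nodes_def K_def)
    ultimately show ?thesis
      using u by (intro exI[of _ "[u, a, b]"]) (auto simp: covers_def inner_nodes_def)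
  next
    case False
    then obtain w where w: "w \<in> T" "w \<noteq> v" "E b w" using dom[of b] ab by blast
    \<comment> \<open>Otherwise \<open>b\<close> would be a neighbour of \<open>X\<close> outside
      \<open>T\<close> and so belong to \<open>K\<close>.\<close>
    have "w \<notin> X" using False ab w E_sym by (auto simp: K_def)
    then have "w \<in> T - plus_set V E X" using far w by blast
    moreover have "T_path E T V [u, a, b, w]"
      using u a ab w False \<open>w \<notin> X\<close> assms(1,3)
      by (auto simp: T_path_def path_in_def inner_nodes_def K_def)
    ultimately show ?thesis
      using u by (intro exI[of _ "[u, a, b, w]"]) (auto simp: covers_def inner_nodes_def card_insert_if)
  qed
qed

lemma shang_step_exists:
  assumes "T \<subseteq> V" "S \<subseteq> V" "conn E T" "k_conn E 2 V"
    and dom: "\<And>y. y \<in> V - T \<Longrightarrow> \<exists>a\<in>T. \<exists>b\<in>T. a \<noteq> b \<and> E y a \<and> E y b"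
    and "\<not> k_conn E 2 (T \<union> S)"
  shows "\<exists>S'. shang_step V E T S S'"
proof -
  obtain X v where X: "X \<subseteq> T" "X \<noteq> {}" "Nbh V E X \<inter> T = {v}" "T - X - {v} \<noteq> {}"
    and uncovered: "\<not> (\<exists>Q. T_path E T (T \<union> S) Q \<and> covers V E T Q X)"
    using uncovered_cut_exists[OF assms(1-3) dom assms(6)] by metis
  have "v \<in> V" using X(3) by (auto simp: Nbh_def)
  then have "conn E (V - {v})" using assms(4) k_conn_2_iff[OF finite_V] by blast
  then obtain P where P: "T_path E T V P" "covers V E T P X" "card (inner_nodes P) \<le> 2"
    using short_covering_T_path_exists[OF assms(1) _ X dom] by blast
  have "T_cut V E T X" using X by (auto simp: T_cut_def plus_set_def)
  then show ?thesis
    using assms(6) X(3) uncovered P unfolding shang_step_def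
    by (intro exI[of _ "S \<union> inner_nodes P"] conjI exI[of _ X] exI[of _ P]) auto
qed

end

section \<open>Existence of a result of the first phase\<close>

context finite_graph
begin

lemma max_independent_in_exists:
  assumes "W \<subseteq> V"
  shows "\<exists>I. max_independent_in E W I"
proof -
  have "{I. independent_in E W I} \<subseteq> Pow V"
    using assms by (auto simp: independent_in_def)
  then have "finite {I. independent_in E W I}"
    using finite_V by (meson finite_Pow_iff finite_subset)
  moreover have "{} \<in> {I. independent_in E W I}" by (simp add: independent_in_def)
  ultimately obtain I where "independent_in E W I" "\<forall>J. independent_in E W J \<longrightarrow> I \<subseteq> J \<longrightarrow> I = J"
    using finite_has_maximal[of "{I. independent_in E W I}"] by auto
  then show ?thesis unfolding max_independent_in_def by metis
qed

lemma max_independent_in_dominates: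
  assumes "max_independent_in E W I" "v \<in> W" "v \<notin> I"
  shows "\<exists>u\<in>I. E v u"
proof (rule ccontr)
  assume "\<not> ?thesis"
  then have "independent_in E W (insert v I)"
    using assms E_irrefl E_sym by (auto simp: max_independent_in_def independent_in_def)
  then have "insert v I = I"
    using assms(1) unfolding max_independent_in_def by blast
  then show False using assms(3) by blast
qed

text \<open>Grow the independent set by nodes at distance two from it, adding the middle nodes to \<open>C\<close>.\<close>

lemma connected_max_independent_set_exists:
  assumes "conn E V"
  shows "\<exists>I C. max_independent_in E V I \<and> C \<subseteq> V - I \<and> card C \<le> card I \<and> conn E (C \<union> I)"
proof -
  \<comment> \<open>Requiring \<open>C\<close> to lie in the neighbourhood of \<open>I\<close>, not
    merely outside \<open>I\<close>, ensures that a later node \<open>b\<close> at distance two from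
    \<open>I\<close> is not in \<open>C\<close>. A pair with \<open>I\<close> of greatest size is
    then shown to be maximal.\<close>
  define Q where "Q = (\<lambda>(I, C). independent_in E V I \<and> C \<subseteq> Nbh V E I \<and> card C \<le> card I \<and> conn E (C \<union> I))"
  have "Q ({}, {})" by (simp add: Q_def independent_in_def conn_def)
  moreover have "\<forall>y. Q y \<longrightarrow> card (fst y) < Suc (card V)"
    using finite_V by (auto simp: Q_def independent_in_def less_Suc_eq_le card_mono)
  ultimately obtain p where "Q p" "\<forall>y. Q y \<longrightarrow> card (fst y) \<le> card (fst p)"
    using ex_has_greatest_nat[of Q "({}, {})" "\<lambda>y. card (fst y)"] by blast
  then obtain I C where Q: "Q (I, C)" and max: "\<And>I' C'. Q (I', C') \<Longrightarrow> card I' \<le> card I"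
    by (cases p) auto
  have I: "independent_in E V I" "I \<subseteq> V" and C: "C \<subseteq> Nbh V E I" "card C \<le> card I" "conn E (C \<union> I)"
    using Q by (auto simp: Q_def independent_in_def)
  have fin: "finite I" "finite C"
    using I C finite_V by (auto simp: Nbh_def intro: finite_subset)
  have "J = I" if J: "independent_in E V J" "I \<subseteq> J" for J
  proof (rule ccontr)
    assume "J \<noteq> I"
    then obtain z where z: "z \<in> J" "z \<notin> I" using J by blast
    have zV: "z \<in> V" and z_far: "z \<notin> I \<union> Nbh V E I"
      using z J by (auto simp: independent_in_def Nbh_def)
    show False
    proof (cases "I = {}")
      case True
      then have "Q ({z}, {})"
        using zV E_irrefl by (auto simp: Q_def independent_in_def conn_iff_reach)
      then show False using max True by force
    next
      case False
      then obtain u where "u \<in> I" by blast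
      then obtain a b where ab: "a \<in> V \<inter> (I \<union> Nbh V E I)" "b \<in> V - (I \<union> Nbh V E I)" "E a b"
        using conn_crossing_edge[OF assms, of u z "I \<union> Nbh V E I"] zV z_far I by blast
      have "a \<in> Nbh V E I" using ab by (auto simp: Nbh_def)
      then obtain w where w: "w \<in> I" "E w a" by (auto simp: Nbh_def)
      have "independent_in E V (insert b I)"
        using I ab E_irrefl E_sym by (auto simp: independent_in_def Nbh_def)
      moreover have "insert a C \<subseteq> Nbh V E (insert b I)"
        using C(1) ab \<open>a \<in> Nbh V E I\<close> E_irrefl by (auto simp: Nbh_def)
      moreover have "card (insert a C) \<le> card (insert b I)"
        using C(2) ab fin by (auto simp: card_insert_if)
      moreover have "conn E (C \<union> I \<union> {a} \<union> {b})"
        using w E_sym ab(3)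
        by (intro conn_Un_dominated[OF symp_E] C(3)) auto
      then have "conn E (insert a C \<union> insert b I)"
        by (simp add: insert_commute)
      ultimately have "Q (insert b I, insert a C)" by (simp add: Q_def)
      then have "card (insert b I) \<le> card I" by (rule max)
      then show False using ab fin by simp
    qed
  qed
  then have "max_independent_in E V I" using I by (auto simp: max_independent_in_def)
  moreover have "C \<subseteq> V - I" using C by (auto simp: Nbh_def)
  ultimately show ?thesis using C by blast
qed

lemma shang_init_exists:
  assumes "conn E V"
  shows "\<exists>T. shang_init V E m T"
proof -
  obtain I1 C where I1: "max_independent_in E V I1"
    and C: "C \<subseteq> V - I1" "card C \<le> card I1" "conn E (C \<union> I1)"
    using connected_max_independent_set_exists[OF assms] by blast
  \<comment> \<open>The choice at \<open>V\<close> is fixed to \<open>I1\<close>, because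
    \<open>C\<close> was built for this first layer.\<close>
  define M where "M W = (if W = V then I1 else SOME J. max_independent_in E W J)" for W
  have M: "max_independent_in E W (M W)" if "W \<subseteq> V" for W
    using someI_ex[OF max_independent_in_exists[OF that]] I1 by (simp add: M_def)
  \<comment> \<open>Each layer depends on all earlier ones, so the recursion runs over the union of
    the first \<open>n\<close> layers.\<close>
  define U where "U = rec_nat {} (\<lambda>_ A. A \<union> M (V - A))"
  have U: "U 0 = {}" "U (Suc n) = U n \<union> M (V - U n)" for n
    by (simp_all add: U_def)
  define I where "I i = (case i of 0 \<Rightarrow> {} | Suc n \<Rightarrow> M (V - U n))" for i
  have "(\<Union>j\<in>{0..n}. I j) = U n" for n
    by (induction n) (auto simp: U I_def atLeast0_atMost_Suc)
  then have "max_independent_in E (V - (\<Union>j\<in>{0..i - 1}. I j)) (I i)" if "i \<in> {1..m}" for i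
    using that M[of "V - U (i - 1)"] by (cases i) (auto simp: I_def)
  moreover have "I 0 = {}" "I 1 = I1" by (simp_all add: I_def U M_def)
  ultimately show ?thesis
    using C unfolding shang_init_def
    by (intro exI[of _ "(\<Union>i\<in>{1..m}. I i) \<union> C"] exI[of _ I] exI[of _ C]) auto
qed

section \<open>Independent sets compared with a CDS\<close>

text \<open>Distinct nonadjacent nodes are placed more than 1 apart, so \<open>p\<close> is
  injective on these neighbours even if it is not on \<open>V\<close>; the disk bound applies with
  centre \<open>p v\<close>.\<close>

lemma card_independent_neighbours:
  assumes "unit_disk_graph V E" "independent_in E V J"
  shows "card {u \<in> J. E v u} \<le> 5"
proof -
  obtain p :: "'a \<Rightarrow> real^2" where p: "\<And>u v. u \<in> V \<Longrightarrow> v \<in> V \<Longrightarrow> u \<noteq> v \<Longrightarrow> E u v \<longleftrightarrow> dist (p u) (p v) \<le> 1"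
    using assms(1) unfolding unit_disk_graph_def by blast
  let ?N = "{u \<in> J. E v u}"
  have sep: "dist (p u) (p w) > 1" if "u \<in> ?N" "w \<in> ?N" "u \<noteq> w" for u w
  proof -
    have "u \<in> V" "w \<in> V" "\<not> E u w" using that assms(2) by (auto simp: independent_in_def)
    then show ?thesis using p[of u w] that(3) by simp
  qed
  have "inj_on p ?N"
    using sep by (intro inj_onI) force
  moreover have "card (p ` ?N) \<le> 5"
  proof (rule card_separated_unit_disk)
    show "dist (p v) a \<le> 1" if "a \<in> p ` ?N" for a
    proof -
      obtain u where "a = p u" "E v u" using \<open>a \<in> p ` ?N\<close> by blast
      then show ?thesis using p[of v u] E_in_V[of v u] E_irrefl[of v] by metis
    qed
    show "1 < dist a b" if "a \<in> p ` ?N" "b \<in> p ` ?N" "a \<noteq> b" for a b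
      using that sep by auto
  qed
  ultimately show ?thesis by (simp add: card_image)
qed

text \<open>This is the double count of the overview with 5 times the common part added to both
  sides; the form without subtraction can be summed over layers in \<open>nat\<close>.\<close>

lemma card_independent_CDS:
  assumes "unit_disk_graph V E" "independent_in E V J" "is_CDS V E k m D"
  shows "m * card (J - D) + 5 * card (J \<inter> D) \<le> 5 * card D"
proof -
  have sub: "J \<subseteq> V" "D \<subseteq> V" using assms by (auto simp: independent_in_def is_CDS_def)
  then have fin: "finite J" "finite D" using finite_V finite_subset by blast+
  have "m * card (J - D) = (\<Sum>x\<in>J - D. m)" by simp
  also have "\<dots> \<le> (\<Sum>x\<in>J - D. card {u \<in> D. E x u})"
    using assms(3) sub by (intro sum_mono) (auto simp: is_CDS_def)
  \<comment> \<open>By independence, the neighbours of a node of \<open>J\<close> lie outside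
    \<open>J\<close>.\<close>
  also have "\<dots> = (\<Sum>x\<in>J - D. card {u \<in> D - J. E x u})"
    using assms(2) by (intro sum.cong arg_cong[of _ _ card]) (auto simp: independent_in_def)
  also have "\<dots> = (\<Sum>u\<in>D - J. card {x \<in> J - D. E x u})"
    using fin by (intro sum_multicount_gen) auto
  also have "\<dots> \<le> (\<Sum>u\<in>D - J. 5)"
  proof (rule sum_mono)
    fix u
    have "card {x \<in> J - D. E x u} \<le> card {x \<in> J. E u x}"
      using fin E_sym by (intro card_mono) auto
    then show "card {x \<in> J - D. E x u} \<le> 5"
      using card_independent_neighbours[OF assms(1,2), of u] by linarith
  qed
  also have "\<dots> = 5 * card (D - J)" by simp
  finally have "m * card (J - D) \<le> 5 * card (D - J)" .
  moreover have "card D = card (D - J) + card (J \<inter> D)"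
    using fin by (metis Int_commute Diff_Int_distrib2 add.commute card_Int_Diff)
  ultimately show ?thesis by simp
qed

text \<open>As \<open>m\<close> is at least 2, the nodes outside \<open>D\<close> have two
  neighbours in it. The 2-connectedness of G supplies the paths the loop looks for.\<close>

lemma k_conn_2_V:
  assumes "2 \<le> m" "is_CDS V E 2 m D"
  shows "k_conn E 2 V"
proof -
  have D: "D \<subseteq> V" "k_conn E 2 D" using assms by (auto simp: is_CDS_def)
  moreover have "\<exists>a\<in>D. \<exists>b\<in>D. a \<noteq> b \<and> E y a \<and> E y b" if "y \<in> V - D" for y
    using that assms unfolding is_CDS_def by (blast intro: two_neighbours order.trans)
  ultimately have "k_conn E 2 (D \<union> (V - D))"
    by (intro k_conn_2_Un_dominated) auto
  moreover have "D \<union> (V - D) = V" using D by blast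
  ultimately show ?thesis by simp
qed

end

section \<open>Structure of \<open>T\<close> for a fixed result of the first phase\<close>

locale independent_layers = finite_graph V E
  for V :: "'a set" and E :: "'a \<Rightarrow> 'a \<Rightarrow> bool" +
  fixes I :: "nat \<Rightarrow> 'a set" and C :: "'a set" and m :: nat
  assumes m_ge_2: "2 \<le> m"
    and I_0: "I 0 = {}"
    and layer: "\<And>i. i \<in> {1..m} \<Longrightarrow> max_independent_in E (V - (\<Union>j\<in>{0..i - 1}. I j)) (I i)"
    and C: "C \<subseteq> V - I 1" "card C \<le> card (I 1)" "conn E (C \<union> I 1)"
begin

definition "U = (\<Union>i\<in>{1..m}. I i)"
definition "T = U \<union> C"

lemma layer_independent: "i \<in> {1..m} \<Longrightarrow> independent_in E V (I i)"
  using layer[of i] by (auto simp: max_independent_in_def independent_in_def)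

lemma U_subset_V: "U \<subseteq> V"
  using layer_independent unfolding U_def independent_in_def by blast

lemma T_subset_V: "T \<subseteq> V"
  using U_subset_V C by (auto simp: T_def)

lemma layers_disjoint:
  assumes "i \<in> {1..m}" "j \<in> {1..m}" "i \<noteq> j"
  shows "I i \<inter> I j = {}"
proof -
  have "I i \<inter> I j = {}" if "i < j" "j \<in> {1..m}" for i j
  proof -
    have "i \<in> {0..j - 1}" using that by auto
    moreover have "I j \<subseteq> V - (\<Union>j\<in>{0..j - 1}. I j)"
      using layer[OF that(2)] by (simp add: max_independent_in_def independent_in_def)
    ultimately show ?thesis by blast
  qed
  then show ?thesis using assms by (metis Int_commute linorder_neqE_nat)
qed

lemma layer_dominates:
  assumes "i \<in> {1..m}" "v \<in> V" "\<And>j. j \<in> {1..i} \<Longrightarrow> v \<notin> I j"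
  shows "\<exists>u\<in>I i. E v u"
proof (rule max_independent_in_dominates[OF layer[OF assms(1)]])
  \<comment> \<open>The index 0 is harmless because \<open>I 0\<close> is empty; all others are
    covered by the assumption.\<close>
  have "v \<notin> I j" if "j \<in> {0..i - 1}" for j
    using that assms(3)[of j] I_0 by (cases "j = 0") auto
  then show "v \<in> V - (\<Union>j\<in>{0..i - 1}. I j)" using assms(2) by blast
  show "v \<notin> I i" using assms(1,3) by auto
qed

text \<open>Each of the \<open>m\<close> disjoint layers contributes its own neighbour.\<close>

lemma card_neighbours_U:
  assumes "v \<in> V - U"
  shows "m \<le> card {u \<in> U. E v u}"
proof -
  have "\<exists>u\<in>I i. E v u" if "i \<in> {1..m}" for i
    using that assms by (intro layer_dominates) (auto simp: U_def)
  then obtain f where f: "\<And>i. i \<in> {1..m} \<Longrightarrow> f i \<in> I i \<and> E v (f i)" by metis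
  have "inj_on f {1..m}"
    using f layers_disjoint by (intro inj_onI) (metis disjoint_iff)
  moreover have "f ` {1..m} \<subseteq> {u \<in> U. E v u}" using f unfolding U_def by blast
  moreover have "finite {u \<in> U. E v u}" using U_subset_V finite_V by (auto intro: finite_subset)
  ultimately have "card {1..m} \<le> card {u \<in> U. E v u}" by (rule card_inj_on_le)
  then show ?thesis by simp
qed

lemma two_neighbours_T:
  assumes "y \<in> V - T"
  shows "\<exists>a\<in>T. \<exists>b\<in>T. a \<noteq> b \<and> E y a \<and> E y b"
proof -
  have "\<exists>a\<in>U. \<exists>b\<in>U. a \<noteq> b \<and> E y a \<and> E y b"
    using card_neighbours_U[of y] assms m_ge_2 by (intro two_neighbours) (auto simp: T_def)
  then show ?thesis by (auto simp: T_def)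
qed

lemma two_neighbours_core:
  assumes "z \<in> V - (C \<union> I 1 \<union> I 2)"
  shows "\<exists>x\<in>C \<union> I 1 \<union> I 2. \<exists>y\<in>C \<union> I 1 \<union> I 2. x \<noteq> y \<and> E z x \<and> E z y"
proof -
  have z: "z \<notin> I j" if "j \<in> {1..2}" for j
  proof -
    have "j = 1 \<or> j = 2" using that by auto
    then show ?thesis using assms by auto
  qed
  have "\<exists>u\<in>I 1. E z u" "\<exists>u\<in>I 2. E z u"
    using assms m_ge_2 z by (auto intro!: layer_dominates)
  then obtain x y where "x \<in> I 1" "E z x" "y \<in> I 2" "E z y" by blast
  moreover have "I 1 \<inter> I 2 = {}" using m_ge_2 by (intro layers_disjoint) auto
  ultimately show ?thesis by (intro bexI[of _ x] bexI[of _ y]) auto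
qed

lemma conn_core: "conn E (C \<union> I 1 \<union> I 2)"
proof -
  have "\<exists>u\<in>I 1. E v u" if "v \<in> I 2" for v
  proof (rule layer_dominates)
    show "v \<in> V" using that layer_independent[of 2] m_ge_2 by (auto simp: independent_in_def)
    show "v \<notin> I j" if "j \<in> {1..1}" for j
      using that \<open>v \<in> I 2\<close> layers_disjoint[of 1 2] m_ge_2 by auto
  qed (use m_ge_2 in auto)
  then show ?thesis by (intro conn_Un_dominated[OF symp_E C(3)]) blast
qed

text \<open>Splits \<open>T\<close> into the connected core and the nodes dominated twice by it, the
  shape in which \<open>conn_Un_dominated\<close> and \<open>excess_Un_le\<close> apply.\<close>

lemma T_eq: "T = (C \<union> I 1 \<union> I 2) \<union> (T - (C \<union> I 1 \<union> I 2))"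
proof -
  have "1 \<in> {1..m}" "2 \<in> {1..m}" using m_ge_2 by auto
  then show ?thesis unfolding T_def U_def by blast
qed

lemma conn_T: "conn E T"
proof (subst T_eq, rule conn_Un_dominated[OF symp_E conn_core])
  show "\<exists>x\<in>C \<union> I 1 \<union> I 2. E y x" if "y \<in> T - (C \<union> I 1 \<union> I 2)" for y
    using two_neighbours_core[of y] that T_subset_V by blast
qed

lemma finite_layer: "i \<in> {1..m} \<Longrightarrow> finite (I i)"
  using layer_independent[of i] finite_V by (auto simp: independent_in_def intro: finite_subset)

lemma excess_T: "excess E T {} \<le> 2 * card (I 1) + card (I 2)"
proof -
  have "finite C" using C finite_V by (auto intro: finite_subset)
  then have fin: "finite (C \<union> I 1 \<union> I 2)" using finite_layer m_ge_2 by auto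
  have "excess E T {} \<le> excess E (C \<union> I 1 \<union> I 2) {}"
  proof (subst T_eq, rule excess_Un_le[OF symp_E fin conn_core])
    show "finite (T - (C \<union> I 1 \<union> I 2))" using T_subset_V finite_V finite_subset by auto
  qed (use two_neighbours_core T_subset_V in blast)
  also have "\<dots> \<le> card (C \<union> I 1 \<union> I 2)"
    by (rule excess_le_card[OF symp_E fin conn_core])
  also have "\<dots> \<le> card C + card (I 1) + card (I 2)"
    by (meson add_right_mono card_Un_le le_trans)
  finally show ?thesis using C(2) by linarith
qed

text \<open>The coefficient 5 of \<open>I 1\<close> is 1 for \<open>C\<close> plus 4 from the
  iterations: \<open>S\<close> has at most twice the excess, hence at most 4 times
  \<open>card (I 1)\<close> plus 2 times \<open>card (I 2)\<close> nodes.\<close>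

lemma card_output:
  assumes "(shang_step V E T)\<^sup>*\<^sup>* {} S"
  shows "card (T \<union> S) \<le> card U + 5 * card (I 1) + 2 * card (I 2)"
proof -
  have "card (T \<union> S) \<le> card U + card C + card S"
    unfolding T_def by (meson add_right_mono card_Un_le le_trans)
  then show ?thesis
    using shang_run(2)[OF assms T_subset_V] excess_T C(2) by linarith
qed

lemma output_is_CDS:
  assumes "(shang_step V E T)\<^sup>*\<^sup>* {} S" "k_conn E 2 (T \<union> S)"
  shows "is_CDS V E 2 m (T \<union> S)"
proof -
  have S: "S \<subseteq> V" using shang_run(1)[OF assms(1) T_subset_V] .
  have "m \<le> card {u \<in> T \<union> S. E v u}" if "v \<in> V - (T \<union> S)" for v
  proof -
    have "m \<le> card {u \<in> U. E v u}" using that by (intro card_neighbours_U) (auto simp: T_def)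
    also have "\<dots> \<le> card {u \<in> T \<union> S. E v u}"
      using S T_subset_V finite_V by (intro card_mono) (auto simp: T_def intro: finite_subset)
    finally show ?thesis .
  qed
  then show ?thesis using assms(2) S T_subset_V by (auto simp: is_CDS_def)
qed

section \<open>Bounds against an arbitrary CDS\<close>

text \<open>With a and b the parts inside and outside \<open>D\<close>, m b + 5 a <= 5 |D|. The left
  side is at least m (a + b) if m <= 5, and at least 5 (a + b) if m >= 6.\<close>

lemma card_layer:
  assumes "unit_disk_graph V E" "is_CDS V E 2 m D" "i \<in> {1..m}"
  shows "m \<le> 5 \<Longrightarrow> m * card (I i) \<le> 5 * card D"
    and "6 \<le> m \<Longrightarrow> card (I i) \<le> card D"
proof -
  let ?a = "card (I i \<inter> D)" and ?b = "card (I i - D)"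
  have *: "m * ?b + 5 * ?a \<le> 5 * card D"
    by (rule card_independent_CDS[OF assms(1) layer_independent[OF assms(3)] assms(2)])
  have ab: "card (I i) = ?a + ?b"
    using finite_layer[OF assms(3)] by (rule card_Int_Diff)
  have "finite D" using assms(2) finite_V by (auto simp: is_CDS_def intro: finite_subset)
  show "m * card (I i) \<le> 5 * card D" if "m \<le> 5"
    using * mult_le_mono1[OF that, of ?a] unfolding ab distrib_left by linarith
  show "card (I i) \<le> card D" if "6 \<le> m"
    using * mult_le_mono1[OF that, of ?b] unfolding ab by linarith
qed

text \<open>Summing over the layers gives m b + 5 a <= 5 m |D|, and disjointness gives a <= |D|. For
  m >= 6, adding (m - 5) a <= (m - 5) |D| yields m (a + b) <= (6 m - 5) |D|.\<close>

lemma card_U: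
  assumes "unit_disk_graph V E" "is_CDS V E 2 m D"
  shows "m \<le> 5 \<Longrightarrow> card U \<le> 5 * card D"
    and "6 \<le> m \<Longrightarrow> real (card U) \<le> (6 - 5 / m) * card D"
proof -
  define a where "a = (\<Sum>i\<in>{1..m}. card (I i \<inter> D))"
  define b where "b = (\<Sum>i\<in>{1..m}. card (I i - D))"
  have finD: "finite D" using assms(2) finite_V by (auto simp: is_CDS_def intro: finite_subset)
  have "(\<Sum>i\<in>{1..m}. m * card (I i - D) + 5 * card (I i \<inter> D)) \<le> (\<Sum>i\<in>{1..m}. 5 * card D)"
    by (intro sum_mono card_independent_CDS[OF assms(1) layer_independent assms(2)])
  then have *: "m * b + 5 * a \<le> m * (5 * card D)"
    by (simp add: a_def b_def sum.distrib sum_distrib_left)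
  have "card U \<le> (\<Sum>i\<in>{1..m}. card (I i))"
    unfolding U_def by (rule card_UN_le) simp
  also have "\<dots> = a + b"
    unfolding a_def b_def sum.distrib[symmetric]
    by (intro sum.cong card_Int_Diff finite_layer) auto
  finally have U: "card U \<le> a + b" .
  have "a = card (\<Union>i\<in>{1..m}. I i \<inter> D)"
    unfolding a_def using finD layers_disjoint
    by (intro card_UN_disjoint[symmetric]) (auto simp: disjoint_iff)
  also have "\<dots> \<le> card D" using finD by (intro card_mono) auto
  finally have a: "a \<le> card D" .
  show "card U \<le> 5 * card D" if "m \<le> 5"
  proof -
    have "m * (a + b) \<le> m * (5 * card D)"
      using * mult_le_mono1[OF that, of a] unfolding distrib_left by linarith
    then show ?thesis using U m_ge_2 by simp
  qed
  show "real (card U) \<le> (6 - 5 / m) * card D" if "6 \<le> m"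
  proof -
    have "real m * b + 5 * a \<le> real m * (5 * card D)"
      using of_nat_mono[OF *, where 'a = real] by simp
    moreover have "(real m - 5) * a \<le> (real m - 5) * card D"
      using that a by (intro mult_left_mono) auto
    ultimately have "real m * (a + b) \<le> (6 * real m - 5) * card D"
      by (simp add: algebra_simps)
    moreover have "real m * card U \<le> real m * (a + b)"
      using U by (intro mult_left_mono) auto
    ultimately show ?thesis
      using that by (simp add: field_simps)
  qed
qed

text \<open>The seven layer terms of \<open>card_output\<close> add 7 * 5 / m to 5 in the first
  case, and 7 to 6 - 5 / m in the second.\<close>

lemma card_output_CDS:
  assumes "unit_disk_graph V E" "is_CDS V E 2 m D" "(shang_step V E T)\<^sup>*\<^sup>* {} S"
  shows "m \<le> 5 \<Longrightarrow> real (card (T \<union> S)) \<le> (5 + 35 / real m) * card D"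
    and "6 \<le> m \<Longrightarrow> real (card (T \<union> S)) \<le> (13 - 5 / real m) * card D"
proof -
  have i: "1 \<in> {1..m}" "2 \<in> {1..m}" using m_ge_2 by auto
  have *: "real (card (T \<union> S)) \<le> card U + 5 * card (I 1) + 2 * card (I 2)"
    using card_output[OF assms(3)] by (simp flip: of_nat_add of_nat_mult)
  show "real (card (T \<union> S)) \<le> (5 + 35 / real m) * card D" if m: "m \<le> 5"
  proof -
    have "real (card (I j)) \<le> 5 / m * card D" if "j \<in> {1..m}" for j
    proof -
      have "real m * card (I j) \<le> 5 * card D"
        using card_layer(1)[OF assms(1,2) that m] by (metis of_nat_le_iff of_nat_mult of_nat_numeral)
      then show ?thesis using m_ge_2 by (simp add: field_simps)
    qed
    from this[OF i(1)] this[OF i(2)] have "5 * real (card (I 1)) + 2 * real (card (I 2)) \<le> 35 / m * card D"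
      by simp
    moreover have "real (card U) \<le> 5 * card D"
      using card_U(1)[OF assms(1,2) m] by linarith
    ultimately show ?thesis using * by (simp add: distrib_right)
  qed
  show "real (card (T \<union> S)) \<le> (13 - 5 / real m) * card D" if m: "6 \<le> m"
    using * card_layer(2)[OF assms(1,2) i(1) m] card_layer(2)[OF assms(1,2) i(2) m]
      card_U(2)[OF assms(1,2) m]
    by (simp add: left_diff_distrib)
qed

end

section \<open>Assembly of the theorem\<close>

lemma shang_init_layers:
  assumes "simple_graph V E" "2 \<le> m" "shang_init V E m T"
  obtains I C where "independent_layers V E I C m" "T = independent_layers.T I C m"
proof -
  obtain I C where I: "I 0 = {}"
    "\<forall>i\<in>{1..m}. max_independent_in E (V - (\<Union>j\<in>{0..i - 1}. I j)) (I i)"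
    "C \<subseteq> V - I 1" "card C \<le> card (I 1)" "conn E (C \<union> I 1)" "T = (\<Union>i\<in>{1..m}. I i) \<union> C"
    using assms(3) unfolding shang_init_def by blast
  then have L: "independent_layers V E I C m"
    using assms by unfold_locales auto
  then show thesis
    using that[OF L] I(6) by (simp add: independent_layers.T_def independent_layers.U_def)
qed

theorem theorem4:
  fixes V :: "'a set" and E :: "'a \<Rightarrow> 'a \<Rightarrow> bool" and m :: nat
  assumes "m \<ge> 2"
    and "unit_disk_graph V E"
    and "\<exists>D. is_CDS V E 2 m D"
  shows "shang_total V E m \<and>
    (\<forall>A. shang_output V E m A \<longrightarrow>
       is_CDS V E 2 m A \<and>
       (m \<le> 5 \<longrightarrow> real (card A) \<le> (5 + 35 / real m) * real (CDS_opt V E 2 m)) \<and>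
       (m \<ge> 6 \<longrightarrow> real (card A) \<le> (13 - 5 / real m) * real (CDS_opt V E 2 m)))"
proof (intro conjI allI impI)
  have simple: "simple_graph V E" using assms(2) by (simp add: unit_disk_graph_def)
  interpret finite_graph V E using simple by unfold_locales
  have V2: "k_conn E 2 V" using assms(3) k_conn_2_V[OF assms(1)] by blast
  then have "conn E V" using k_conn_2_iff[OF finite_V] by blast
  have "\<not> (\<exists>f :: nat \<Rightarrow> 'a set. f 0 = {} \<and> (\<forall>n. shang_step V E T (f n) (f (Suc n)))) \<and>
      (\<forall>S. (shang_step V E T)\<^sup>*\<^sup>* {} S \<and> \<not> k_conn E 2 (T \<union> S) \<longrightarrow> (\<exists>S'. shang_step V E T S S'))"
    if T: "shang_init V E m T" for T
  proof -
    obtain I C where L: "independent_layers V E I C m" "T = independent_layers.T I C m"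
      using shang_init_layers[OF simple assms(1) T] .
    interpret independent_layers V E I C m by (rule L)
    show ?thesis
      unfolding L(2)
    proof (intro conjI allI impI)
      show "\<exists>S'. shang_step V E (independent_layers.T I C m) S S'"
        if "(shang_step V E (independent_layers.T I C m))\<^sup>*\<^sup>* {} S \<and>
          \<not> k_conn E 2 (independent_layers.T I C m \<union> S)" for S
        using that shang_run(1)[OF _ T_subset_V]
        by (intro shang_step_exists[OF T_subset_V _ conn_T V2 two_neighbours_T]) auto
    qed (rule shang_loop_terminates[OF T_subset_V])
  qed
  then show "shang_total V E m"
    unfolding shang_total_def using shang_init_exists[OF \<open>conn E V\<close>] by blast

  fix A assume A: "shang_output V E m A"
  then obtain T S where TS: "shang_init V E m T" "(shang_step V E T)\<^sup>*\<^sup>* {} S" "k_conn E 2 (T \<union> S)" "A = T \<union> S"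
    unfolding shang_output_def by blast
  obtain I C where L: "independent_layers V E I C m" "T = independent_layers.T I C m"
    using shang_init_layers[OF simple assms(1) TS(1)] .
  interpret layers: independent_layers V E I C m by (rule L)
  show "is_CDS V E 2 m A"
    using layers.output_is_CDS TS L(2) by simp
  \<comment> \<open>The minimum in \<open>CDS_opt\<close> is attained: \<open>V\<close> has finitely
    many subsets, and some CDS exists by assumption.\<close>
  have "{D. is_CDS V E 2 m D} \<subseteq> Pow V" by (auto simp: is_CDS_def)
  then have "finite {D. is_CDS V E 2 m D}"
    using finite_V by (meson finite_Pow_iff finite_subset)
  then have "CDS_opt V E 2 m \<in> card ` {D. is_CDS V E 2 m D}"
    unfolding CDS_opt_def using assms(3) by (intro Min_in) auto
  then obtain D where D: "is_CDS V E 2 m D" "CDS_opt V E 2 m = card D" by auto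
  show "real (card A) \<le> (5 + 35 / real m) * real (CDS_opt V E 2 m)" if "m \<le> 5"
    using layers.card_output_CDS(1)[OF assms(2) D(1) _ that] TS L(2) D(2) by simp
  show "real (card A) \<le> (13 - 5 / real m) * real (CDS_opt V E 2 m)" if "m \<ge> 6"
    using layers.card_output_CDS(2)[OF assms(2) D(1) _ that] TS L(2) D(2) by simp
qed

end
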